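(* Let $N\ge 1$ be an integer and let $\alpha\in(0,1)$ be a real number. Define $P_{\alpha,N}(0)=0$ and, for integers $1\le L\le N$, $$P_{\alpha,N}(L) = C_{\alpha,N}\binom{N}{L}\left(L\frac{\alpha}{N}\right)^{L-1}\left(1-L\frac{\alpha}{N}\right)^{N-L-1},\qquad C_{\alpha,N}=\frac{1-\alpha}{N-(N-1)\alpha}.$$ Then $P_{\alpha,N}$ is a probability distribution on $\{0,1,\dots,N\}$, i.e. $P_{\alpha,N}(L)\ge 0$ for all $0\le L\le N$ and $\sum_{L=0}^{N}P_{\alpha,N}(L)=1$.
   Context: The function $P_{\alpha,N}$ is called the Abelian distribution with parameters $\alpha$ and $N$. For $L=N$ the last factor has exponent $-1$, so it equals $(1-\alpha)^{-1}$. For $L=1$ the factor $\left(L\frac{\alpha}{N}\right)^{L-1}$ equals $1$. *)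

theory Defs
  imports Complex_Main
begin

definition abelian_const :: "real \<Rightarrow> nat \<Rightarrow> real" where
  "abelian_const \<alpha> N = (1 - \<alpha>) / (real N - (real N - 1) * \<alpha>)"

text \<open>
  The last exponent equals \<open>-1\<close> for \<open>L = N\<close>, hence the integer power \<open>powi\<close>.
  The distribution lives on \<open>{0..N}\<close>; the value \<open>0\<close> for \<open>L > N\<close> only makes the function total.
\<close>

definition abelian_dist :: "real \<Rightarrow> nat \<Rightarrow> nat \<Rightarrow> real" where
  "abelian_dist \<alpha> N L =
     (if 1 \<le> L \<and> L \<le> N then
        abelian_const \<alpha> N * real (N choose L)
          * (real L * (\<alpha> / real N)) ^ (L - 1)
          * (1 - real L * (\<alpha> / real N)) powi (int N - int L - 1)
      else 0)"

end

theory Submission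
  imports Defs
begin

text \<open>
  The limiting case \<open>x \<rightarrow> 0\<close> of Abel's binomial identity reads
  \<open>A\<^sub>n(y) = (\<Sum>L=1..n. (n choose L) (L z)\<^bsup>L-1\<^esup> (y - L z)\<^bsup>n-L\<^esup>) = n y\<^bsup>n-1\<^esup>\<close>.
  It holds because \<open>A\<^sub>n' = n A\<^bsub>n-1\<^esub>\<close>, while \<open>A\<^sub>n(0)\<close> is an \<open>n\<close>-th finite difference of a
  monomial of degree \<open>n - 1\<close>. With \<open>z = \<alpha> / N\<close>, writing
  \<open>1 - \<alpha> = (1 - L z) - (N - L) z\<close> turns \<open>1 - \<alpha>\<close> times the unnormalised total mass into
  \<open>A\<^sub>N(1) - \<alpha> A\<^bsub>N-1\<^esub>(1) = N - \<alpha> (N - 1)\<close>.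
\<close>

lemma of_nat_Suc_choose_absorb:
  "of_nat (Suc i) * of_nat (Suc n choose Suc i) = (of_nat (Suc n) * of_nat (n choose i) :: 'a::comm_semiring_1)"
  using Suc_times_binomial[of i n] by (metis of_nat_mult)

text \<open>No bound on \<open>L\<close> is needed for termwise use in sums: at
  \<open>L = Suc n\<close> the factor \<open>Suc n - L\<close> and \<open>n choose L\<close> are
  both 0, and beyond that both binomials vanish.\<close>

lemma of_nat_Suc_choose_absorb_comp:
  "real (Suc n choose L) * real (Suc n - L) = real (Suc n) * real (n choose L)"
proof (cases "L \<le> n")
  case True
  have "(Suc n - L) * (Suc n choose L) = Suc n * (n choose L)"
    using binomial_absorb_comp[of "Suc n" L] by simp
  then show ?thesis by (metis mult.commute of_nat_mult)
qed (auto simp: binomial_eq_0)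

text \<open>An \<open>n\<close>-th finite difference annihilates polynomials of degree below
  \<open>n\<close>. Splitting one factor \<open>x + i\<close> off the power gives \<open>x\<close>
  times the sum for \<open>k\<close>, plus a sum with weight \<open>i\<close>; absorbing
  \<open>i\<close> into the binomial lowers \<open>n\<close> by one and shifts \<open>x\<close> to
  \<open>x + 1\<close>, so both vary in the induction.\<close>

lemma alternating_binomial_sum_power_eq_0:
  fixes x :: "'a::comm_ring_1"
  assumes "k < n"
  shows "(\<Sum>i\<le>n. (-1) ^ i * of_nat (n choose i) * (x + of_nat i) ^ k) = 0"
  using assms
proof (induction k arbitrary: n x)
  case 0
  then show ?case by (simp add: choose_alternating_sum)
next
  case (Suc k)
  then obtain m where n: "n = Suc m" "k < m" by (cases n) auto
  have "(\<Sum>i\<le>n. (-1) ^ i * of_nat (n choose i) * (x + of_nat i) ^ Suc k) =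
      x * (\<Sum>i\<le>n. (-1) ^ i * of_nat (n choose i) * (x + of_nat i) ^ k) +
      (\<Sum>i\<le>n. (-1) ^ i * (of_nat i * of_nat (n choose i)) * (x + of_nat i) ^ k)"
    by (simp add: sum_distrib_left sum.distrib[symmetric] algebra_simps)
  also have "(\<Sum>i\<le>n. (-1) ^ i * (of_nat i * of_nat (n choose i)) * (x + of_nat i) ^ k) =
      (\<Sum>i\<le>m. (-1) ^ Suc i * (of_nat (Suc i) * of_nat (Suc m choose Suc i)) * (x + of_nat (Suc i)) ^ k)"
    unfolding n by (subst sum.atMost_Suc_shift) simp
  also have "\<dots> = - of_nat (Suc m) * (\<Sum>i\<le>m. (-1) ^ i * of_nat (m choose i) * ((x + 1) + of_nat i) ^ k)"
    unfolding of_nat_Suc_choose_absorb sum_distrib_left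
    by (rule sum.cong) (simp_all add: algebra_simps)
  finally show ?case using Suc.IH[of n x] Suc.IH[of m "x + 1"] n by simp
qed

lemma abel_binomial_limit:
  fixes y z :: real
  shows "(\<Sum>L=1..n. real (n choose L) * (real L * z) ^ (L - 1) * (y - real L * z) ^ (n - L))
    = real n * y ^ (n - 1)"
proof (induction n arbitrary: y)
  case 0
  then show ?case by simp
next
  case (Suc n)
  show ?case
  proof (cases "n = 0")
    case True
    then show ?thesis by simp
  next
    case False
    define F where "F = (\<lambda>y. (\<Sum>L=1..Suc n. real (Suc n choose L) * (real L * z) ^ (L - 1)
        * (y - real L * z) ^ (Suc n - L)) - real (Suc n) * y ^ n)"
    have deriv: "DERIV F t :> 0" for t
    proof -
      \<comment> \<open>The left side is the termwise derivative. At \<open>L = Suc n\<close> the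
        truncated exponent \<open>n - L\<close> is harmless, since the factor
        \<open>Suc n - L\<close> is 0.\<close>
      have "(\<Sum>L=1..Suc n. real (Suc n choose L) * (real L * z) ^ (L - 1)
            * (real (Suc n - L) * (t - real L * z) ^ (n - L)))
          = (\<Sum>L=1..Suc n. real (Suc n) * (real (n choose L) * (real L * z) ^ (L - 1)
            * (t - real L * z) ^ (n - L)))"
      proof (intro sum.cong refl)
        fix L
        show "real (Suc n choose L) * (real L * z) ^ (L - 1) * (real (Suc n - L) * (t - real L * z) ^ (n - L))
            = real (Suc n) * (real (n choose L) * (real L * z) ^ (L - 1) * (t - real L * z) ^ (n - L))"
          using arg_cong[OF of_nat_Suc_choose_absorb_comp[of n L],
              of "\<lambda>u. u * ((real L * z) ^ (L - 1) * (t - real L * z) ^ (n - L))"]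
          by (simp only: mult_ac)
      qed
      also have "\<dots> = real (Suc n) * (real n * t ^ (n - 1))"
        unfolding Suc.IH[symmetric] sum_distrib_left[symmetric] by simp
      finally have "(\<Sum>L=1..Suc n. real (Suc n choose L) * (real L * z) ^ (L - 1)
            * (real (Suc n - L) * (t - real L * z) ^ (n - L)))
          = real (Suc n) * (real n * t ^ (n - 1))" .
      moreover have "DERIV F t :> (\<Sum>L=1..Suc n. real (Suc n choose L) * (real L * z) ^ (L - 1)
            * (real (Suc n - L) * (t - real L * z) ^ (n - L)))
          - real (Suc n) * (real n * t ^ (n - 1))"
        unfolding F_def
        by (intro DERIV_diff DERIV_sum DERIV_cmult)
          (auto intro!: derivative_eq_intros)
      ultimately show ?thesis by simp
    qed
    have "F y = F 0"
      using DERIV_isconst_all deriv by blast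
    \<comment> \<open>At \<open>y = 0\<close> the exponents \<open>L - 1\<close> and
      \<open>Suc n - L\<close> fall on the same base up to sign and add up to \<open>n\<close>. The
      subtracted \<open>y ^ n\<close> vanishes because \<open>n\<close> is positive.\<close>
    also have "F 0 = (\<Sum>L=1..Suc n. z ^ n * (-1) ^ Suc n
        * ((-1) ^ L * real (Suc n choose L) * (0 + real L) ^ n))"
    proof -
      have "real (Suc n choose L) * (real L * z) ^ (L - 1) * (0 - real L * z) ^ (Suc n - L)
        = z ^ n * (-1) ^ Suc n * ((-1) ^ L * real (Suc n choose L) * (0 + real L) ^ n)"
        if "L \<in> {1..Suc n}" for L
      proof -
        have "(0 - real L * z) ^ (Suc n - L) = (-1) ^ (Suc n - L) * (real L * z) ^ (Suc n - L)"
          by (simp flip: power_mult_distrib)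
        moreover have "(-1::real) ^ (Suc n - L) = (-1) ^ Suc n * (-1) ^ L"
          using that by (auto simp: minus_one_power_iff)
        moreover have "(real L * z) ^ (L - 1) * (real L * z) ^ (Suc n - L) = real L ^ n * z ^ n"
          using that by (simp flip: power_add power_mult_distrib)
        ultimately show ?thesis
          by (simp only: mult_ac add_0)
      qed
      then show ?thesis unfolding F_def using False by simp
    qed
    \<comment> \<open>The added term \<open>L = 0\<close> is zero, again because \<open>n\<close> is
      positive.\<close>
    also have "\<dots> = z ^ n * (-1) ^ Suc n *
        (\<Sum>L\<le>Suc n. (-1) ^ L * real (Suc n choose L) * (0 + real L) ^ n)"
      unfolding sum_distrib_left
      by (rule sum.mono_neutral_left) (use False in \<open>auto simp: not_le\<close>)
    also have "\<dots> = 0"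
      using alternating_binomial_sum_power_eq_0[of n "Suc n" "0::real"] by simp
    finally show ?thesis by (simp add: F_def)
  qed
qed

lemma abelian_weight_sum:
  fixes \<alpha> :: real
  assumes "N \<ge> 1" "\<alpha> \<noteq> 1"
  shows "(\<Sum>L=1..N. real (N choose L) * (real L * (\<alpha> / real N)) ^ (L - 1)
      * (1 - real L * (\<alpha> / real N)) powi (int N - int L - 1)) * (1 - \<alpha>)
    = real N - (real N - 1) * \<alpha>"
proof -
  obtain m where N: "N = Suc m" using assms by (cases N) auto
  define z where "z = \<alpha> / real N"
  have Nz: "real N * z = \<alpha>" using assms by (simp add: z_def)
  have split: "real (N choose L) * (real L * z) ^ (L - 1) * (1 - real L * z) powi (int N - int L - 1) * (1 - \<alpha>)
     = real (N choose L) * (real L * z) ^ (L - 1) * (1 - real L * z) ^ (N - L)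
      - \<alpha> * (real (m choose L) * (real L * z) ^ (L - 1) * (1 - real L * z) ^ (m - L))"
    if L: "L \<in> {1..N}" for L
  \<comment> \<open>For \<open>L = N\<close> the base is \<open>1 - \<alpha>\<close> with exponent
    -1, so the factor \<open>1 - \<alpha>\<close> cancels it, and \<open>m choose N\<close> is
    0.\<close>
  proof (cases "L = N")
    case True
    then show ?thesis using assms Nz by (simp add: N power_int_minus binomial_eq_0)
  next
    case False
    then have Lm: "L \<le> m" using L N by auto
    then have e: "int N - int L - 1 = int (m - L)" "N - L = Suc (m - L)" using N by auto
    have "\<alpha> * real (m choose L) = z * (real (N choose L) * real (N - L))"
      using of_nat_Suc_choose_absorb_comp[of m L] unfolding N Nz[symmetric] by simp
    moreover have "1 - \<alpha> = (1 - real L * z) - real (N - L) * z"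
      using Nz L by (simp add: of_nat_diff algebra_simps)
    \<comment> \<open>Here \<open>c\<close>, \<open>d\<close> stand for the binomials of
      \<open>N\<close> and \<open>m\<close>, \<open>k\<close> for \<open>N - L\<close>,
      \<open>v\<close> for \<open>1 - real L * z\<close>, \<open>w\<close> for the power of
      \<open>real L * z\<close> and \<open>q\<close> for \<open>v ^ (m - L)\<close>.\<close>
    moreover have "c * w * q * (1 - \<alpha>) = c * w * (v * q) - \<alpha> * (d * w * q)"
      if "\<alpha> * d = z * (c * k)" "1 - \<alpha> = v - k * z" for c d k q v w :: real
      using that by algebra
    ultimately show ?thesis
      unfolding e(1) power_int_of_nat using e(2) by (metis power_Suc)
  qed
  have "(\<Sum>L=1..N. real (N choose L) * (real L * z) ^ (L - 1)
      * (1 - real L * z) powi (int N - int L - 1)) * (1 - \<alpha>)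
    = (\<Sum>L=1..N. real (N choose L) * (real L * z) ^ (L - 1) * (1 - real L * z) ^ (N - L))
      - \<alpha> * (\<Sum>L=1..N. real (m choose L) * (real L * z) ^ (L - 1) * (1 - real L * z) ^ (m - L))"
    unfolding sum_distrib_right sum_distrib_left sum_subtractf[symmetric]
    by (rule sum.cong[OF refl split])
  also have "(\<Sum>L=1..N. real (m choose L) * (real L * z) ^ (L - 1) * (1 - real L * z) ^ (m - L))
    = (\<Sum>L=1..m. real (m choose L) * (real L * z) ^ (L - 1) * (1 - real L * z) ^ (m - L))"
    by (simp add: N)
  finally show ?thesis
    unfolding abel_binomial_limit z_def by (simp add: N algebra_simps)
qed

theorem lemma2p1:
  fixes N :: nat and \<alpha> :: real
  assumes "N \<ge> 1" and "0 < \<alpha>" and "\<alpha> < 1"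
  shows "(\<forall>L\<in>{0..N}. abelian_dist \<alpha> N L \<ge> 0) \<and> (\<Sum>L=0..N. abelian_dist \<alpha> N L) = 1"
proof
  have "(real N - 1) * \<alpha> \<le> real N - 1"
    using assms by (simp add: mult_left_le)
  then have den: "real N - (real N - 1) * \<alpha> > 0" by linarith
  show "\<forall>L\<in>{0..N}. abelian_dist \<alpha> N L \<ge> 0"
  proof
    fix L assume "L \<in> {0..N}"
    then have "real L * (\<alpha> / real N) \<le> real N * (\<alpha> / real N)"
      using assms by (intro mult_right_mono) auto
    also have "real N * (\<alpha> / real N) = \<alpha>" using assms by simp
    \<comment> \<open>The base of the integer power is thus nonnegative, which suffices for every
      exponent, including -1.\<close>
    finally have "real L * (\<alpha> / real N) \<le> 1" using assms by linarith
    then show "abelian_dist \<alpha> N L \<ge> 0"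
      using assms den unfolding abelian_dist_def abelian_const_def
      by (auto intro!: mult_nonneg_nonneg divide_nonneg_nonneg)
  qed
  have "(\<Sum>L=0..N. abelian_dist \<alpha> N L) = (\<Sum>L=1..N. abelian_dist \<alpha> N L)"
    by (rule sum.mono_neutral_right) (auto simp: abelian_dist_def)
  also have "\<dots> = abelian_const \<alpha> N * (\<Sum>L=1..N. real (N choose L)
      * (real L * (\<alpha> / real N)) ^ (L - 1)
      * (1 - real L * (\<alpha> / real N)) powi (int N - int L - 1))"
    unfolding sum_distrib_left by (rule sum.cong) (auto simp: abelian_dist_def mult_ac)
  also have "\<dots> = 1"
    using abelian_weight_sum[of N \<alpha>] assms den
    by (simp add: abelian_const_def mult_ac)
  finally show "(\<Sum>L=0..N. abelian_dist \<alpha> N L) = 1" .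
qed

end
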